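(* The shortest closed bounded curvature path is the boundary of a unit disk: a closed bounded curvature path of least length among all closed bounded curvature paths is the boundary circle of a disk of radius $1$ (traversed once). In particular, every closed bounded curvature path has length at least $2\pi$.
   Context: A bounded curvature path is a $C^1$ and piecewise $C^2$ path $\gamma:[0,s]\to\mathbb{R}^2$, $s>0$, parametrised by arc length ($\|\gamma'(t)\|=1$ for all $t\in[0,s]$), with $\|\gamma''(t)\|\le 1$ wherever $\gamma''(t)$ is defined (the curvature bound is normalised to $1$). Its length is $s$. It is closed if $\gamma(0)=\gamma(s)$. *)

theory Defs
  imports "HOL-Analysis.Analysis"
begin

text \<open>
  A path is a pair of a map and a length \<open>s\<close>; only the values of the map on \<open>{0..s}\<close> matter.
  Since \<open>s > 0\<close>, the derivative \<open>\<gamma>'\<close> is uniquely determined on \<open>{0..s}\<close> (one-sided at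
  the two end points). Being piecewise \<open>C\<^sup>2\<close> is expressed as the derivative being piecewise
  \<open>C\<^sup>1\<close>; continuity of \<open>\<gamma>'\<close> on all of \<open>{0..s}\<close> is part of that library notion.
  The curvature bound is imposed at every point at which \<open>\<gamma>'\<close> happens to be differentiable,
  break points included.
\<close>

definition bounded_curvature_path :: "(real \<Rightarrow> real^2) \<Rightarrow> real \<Rightarrow> bool" where
  "bounded_curvature_path \<gamma> s \<longleftrightarrow>
     s > 0 \<and>
     (\<exists>\<gamma>'. (\<forall>t\<in>{0..s}. (\<gamma> has_vector_derivative \<gamma>' t) (at t within {0..s})) \<and>
           continuous_on {0..s} \<gamma>' \<and>
           \<gamma>' piecewise_C1_differentiable_on {0..s} \<and>
           (\<forall>t\<in>{0..s}. norm (\<gamma>' t) = 1) \<and>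
           (\<forall>t\<in>{0..s}. \<forall>a. (\<gamma>' has_vector_derivative a) (at t within {0..s})
                             \<longrightarrow> norm a \<le> 1))"

text \<open>Only the end points have to agree, not the end tangents.\<close>

definition closed_bounded_curvature_path :: "(real \<Rightarrow> real^2) \<Rightarrow> real \<Rightarrow> bool" where
  "closed_bounded_curvature_path \<gamma> s \<longleftrightarrow> bounded_curvature_path \<gamma> s \<and> \<gamma> 0 = \<gamma> s"

text \<open>Paths are parametrised by arc length, so the length of \<open>\<gamma>\<close> on \<open>{0..s}\<close> is \<open>s\<close>.\<close>

definition shortest_closed_bounded_curvature_path :: "(real \<Rightarrow> real^2) \<Rightarrow> real \<Rightarrow> bool" where
  "shortest_closed_bounded_curvature_path \<gamma> s \<longleftrightarrow>
     closed_bounded_curvature_path \<gamma> s \<and>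
     (\<forall>\<delta> r. closed_bounded_curvature_path \<delta> r \<longrightarrow> s \<le> r)"

definition traverses_once :: "(real \<Rightarrow> real^2) \<Rightarrow> real \<Rightarrow> (real^2) set \<Rightarrow> bool" where
  "traverses_once \<gamma> s C \<longleftrightarrow> \<gamma> ` {0..s} = C \<and> inj_on \<gamma> {0..<s} \<and> \<gamma> 0 = \<gamma> s"

end

theory Submission
  imports Defs
begin

text \<open>
  Write the unit tangent of a bounded curvature path as \<open>(cos \<theta>, sin \<theta>)\<close> with a continuous
  angle \<open>\<theta>\<close>. The curvature bound says that \<open>\<theta>\<close> is 1-Lipschitz (\<open>bounded_curvature_path_angle\<close>).
  Measure the displacement of the path in the direction of its tangent at the midpoint
  \<open>m = s/2\<close>. Its rate at time \<open>t\<close> is \<open>cos (\<theta> t - \<theta> m)\<close>, and this is at least \<open>cos (t - m)\<close>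
  as long as \<open>\<bar>t - m\<bar> \<le> \<pi>\<close>, that is, for \<open>s \<le> 2\<pi>\<close>. So the total displacement is at
  least the chord \<open>2 sin (s/2)\<close> of an arc of length \<open>s\<close> of the unit circle. This is positive
  for \<open>s < 2\<pi>\<close>, and hence a closed path has length at least \<open>2\<pi>\<close>.

  For \<open>s = 2\<pi>\<close> equality must hold throughout, so that \<open>\<bar>\<theta> t - \<theta> m\<bar> = \<bar>t - m\<bar>\<close> for all \<open>t\<close>
  (\<open>short_closed_path_angle_from_midpoint\<close>). The Lipschitz bound makes the path turn with
  constant curvature \<open>1\<close> or \<open>-1\<close> on each side of \<open>m\<close>. If the two signs differed, the path
  would be an S of two semicircles whose displacement along the normal at \<open>m\<close> has a constant
  sign and does not vanish, so it would not close up (\<open>closed_path_turns_one_way\<close>). With equal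
  signs the path is a unit circle, traversed once. The standard unit circle is itself a closed
  bounded curvature path of length \<open>2\<pi>\<close>, so the minimum is attained.
\<close>

section \<open>Monotonicity from derivatives\<close>

text \<open>
  The tangent of a piecewise \<open>C\<^sup>2\<close> path may fail to be differentiable at finitely many points.
  The fundamental theorem of calculus for the Henstock--Kurzweil integral tolerates them.
\<close>

lemma lipschitz_if_deriv_le_1_off_finite:
  fixes f :: "real \<Rightarrow> real"
  assumes "a \<le> b" "finite S" and cont: "continuous_on {a..b} f"
    and der: "\<And>t. t \<in> {a<..<b} - S \<Longrightarrow> \<exists>d. (f has_real_derivative d) (at t) \<and> \<bar>d\<bar> \<le> 1"
  shows "\<bar>f b - f a\<bar> \<le> b - a"
proof -
  obtain d where d: "\<And>t. t \<in> {a<..<b} - S \<Longrightarrow> (f has_real_derivative d t) (at t) \<and> \<bar>d t\<bar> \<le> 1"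
    using der by metis
  \<comment> \<open>The value 0 at the exceptional points makes the bound 1 hold everywhere.\<close>
  define e where "e t = (if t \<in> {a<..<b} - S then d t else 0)" for t
  have "(e has_integral (f b - f a)) {a..b}"
  proof (rule fundamental_theorem_of_calculus_interior_strong[OF \<open>finite S\<close> \<open>a \<le> b\<close> _ cont])
    fix t assume "t \<in> {a<..<b} - S"
    then show "(f has_vector_derivative e t) (at t)"
      using d[of t] unfolding e_def has_real_derivative_iff_has_vector_derivative by auto
  qed
  moreover have "\<bar>e t\<bar> \<le> 1" for t
    using d[of t] by (auto simp: e_def)
  ultimately have "norm (f b - f a) \<le> 1 * measure lborel {a..b}"
    by (intro has_integral_bound_real[where f = e]) auto
  then show ?thesis
    using \<open>a \<le> b\<close> by simp
qed

lemma nonneg_deriv_imp_mono_on: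
  fixes f f' :: "real \<Rightarrow> real"
  assumes der: "\<And>t. t \<in> {a..b} \<Longrightarrow> (f has_real_derivative f' t) (at t within {a..b})"
    and nonneg: "\<And>t. t \<in> {a..b} \<Longrightarrow> 0 \<le> f' t"
  shows "mono_on {a..b} f"
proof (rule mono_onI)
  fix x y assume xy: "x \<in> {a..b}" "y \<in> {a..b}" "x \<le> y"
  show "f x \<le> f y"
  proof (rule DERIV_nonneg_imp_increasing_open[OF \<open>x \<le> y\<close>])
    fix z assume z: "x < z" "z < y"
    then have "(f has_real_derivative f' z) (at z)"
      using der[of z] xy by (simp add: at_within_Icc_at)
    then show "\<exists>d. (f has_real_derivative d) (at z) \<and> 0 \<le> d"
      using nonneg[of z] z xy by auto
  next
    have "continuous_on {a..b} f"
      using der by (metis DERIV_continuous_on)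
    then show "continuous_on {x..y} f"
      by (rule continuous_on_subset) (use xy in auto)
  qed
qed

text \<open>
  The rigidity principle behind the equality case: a nondecreasing function that returns to its
  initial value is constant. It is used both for the displacement along the tangent at the
  midpoint and for that along the normal.
\<close>

lemma nonneg_deriv_eq_0_if_no_increase:
  fixes f f' :: "real \<Rightarrow> real"
  assumes "a < b"
    and der: "\<And>t. t \<in> {a..b} \<Longrightarrow> (f has_real_derivative f' t) (at t within {a..b})"
    and nonneg: "\<And>t. t \<in> {a..b} \<Longrightarrow> 0 \<le> f' t"
    and "f b \<le> f a" and t: "t \<in> {a..b}"
  shows "f' t = 0"
proof -
  have const: "f x = f a" if "x \<in> {a..b}" for x
  proof -
    have "f a \<le> f x" "f x \<le> f b"
      using monotone_onD[OF nonneg_deriv_imp_mono_on[OF der nonneg]] that by auto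
    then show ?thesis
      using \<open>f b \<le> f a\<close> by simp
  qed
  have "((\<lambda>x. f a) has_vector_derivative f' t) (at t within {a..b})"
    using der[OF t] unfolding has_real_derivative_iff_has_vector_derivative
    by (rule has_vector_derivative_transform[OF t, rotated]) (rule const[symmetric])
  then show ?thesis
    using vector_derivative_unique_within_closed_interval[OF \<open>a < b\<close>, of t "\<lambda>x. f a" "f' t" 0] t
    by simp
qed

section \<open>The tangent angle\<close>

lemma norm_real2_squared:
  fixes v :: "real^2"
  shows "(norm v)\<^sup>2 = (v$1)\<^sup>2 + (v$2)\<^sup>2"
  by (simp add: norm_vec_def L2_set_def sum_2)

text \<open>
  Read in the complex plane, the tangent is a continuous map from an interval to the unit circle;
  it has a continuous logarithm because an interval is contractible.
\<close>

lemma ex_continuous_angle: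
  fixes T :: "real \<Rightarrow> real^2"
  assumes cont: "continuous_on {0..s} T" and unit: "\<And>t. t \<in> {0..s} \<Longrightarrow> norm (T t) = 1"
  obtains \<theta> where "continuous_on {0..s} \<theta>"
    "\<And>t. t \<in> {0..s} \<Longrightarrow> T t $ 1 = cos (\<theta> t)" "\<And>t. t \<in> {0..s} \<Longrightarrow> T t $ 2 = sin (\<theta> t)"
proof -
  define f where "f t = Complex (T t $ 1) (T t $ 2)" for t
  have norm_f: "norm (f t) = 1" if "t \<in> {0..s}" for t
    using unit[OF that] norm_real2_squared[of "T t"] by (simp add: f_def cmod_def)
  have "continuous_on {0..s} f"
    unfolding f_def Complex_eq by (intro continuous_intros cont)
  moreover have "contractible {0..s}"
    by (simp add: convex_imp_contractible)
  moreover have "f t \<noteq> 0" if "t \<in> {0..s}" for t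
    using norm_f[OF that] by auto
  ultimately obtain g where g: "continuous_on {0..s} g" "\<And>t. t \<in> {0..s} \<Longrightarrow> f t = exp (g t)"
    using continuous_logarithm_on_contractible by metis
  have Re_g: "Re (g t) = 0" if "t \<in> {0..s}" for t
    using norm_f[OF that] g(2)[OF that] by simp
  show ?thesis
  proof
    show "continuous_on {0..s} (\<lambda>t. Im (g t))"
      by (intro continuous_intros g(1))
    fix t assume t: "t \<in> {0..s}"
    show "T t $ 1 = cos (Im (g t))"
      using arg_cong[OF g(2)[OF t], of Re] Re_g[OF t] by (simp add: f_def Re_exp)
    show "T t $ 2 = sin (Im (g t))"
      using arg_cong[OF g(2)[OF t], of Im] Re_g[OF t] by (simp add: f_def Im_exp)
  qed
qed

text \<open>
  Near \<open>t\<close> the angle is \<open>\<theta> t + arcsin \<psi>\<close>, where \<open>\<psi>\<close> is the component of \<open>T\<close> along the unit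
  normal \<open>(- sin (\<theta> t), cos (\<theta> t))\<close>. Since \<open>arcsin\<close> has derivative 1 at 0, the derivative of the
  angle is the normal component of \<open>a\<close>, hence at most \<open>norm a\<close> in modulus.
\<close>

lemma angle_has_bounded_derivative:
  fixes T :: "real \<Rightarrow> real^2"
  assumes der: "(T has_vector_derivative a) (at t)" and cont: "isCont \<theta> t"
    and polar: "\<forall>\<^sub>F x in nhds t. T x $ 1 = cos (\<theta> x) \<and> T x $ 2 = sin (\<theta> x)"
  shows "\<exists>d. (\<theta> has_real_derivative d) (at t) \<and> \<bar>d\<bar> \<le> norm a"
proof -
  define \<psi> where "\<psi> x = T x $ 2 * cos (\<theta> t) - T x $ 1 * sin (\<theta> t)" for x
  define d where "d = a $ 2 * cos (\<theta> t) - a $ 1 * sin (\<theta> t)"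
  have comp: "((\<lambda>x. T x $ i) has_real_derivative a $ i) (at t)" for i
    using bounded_linear.has_vector_derivative[OF bounded_linear_vec_nth der]
    by (simp add: has_real_derivative_iff_has_vector_derivative)
  have \<psi>t: "\<psi> t = 0"
    using eventually_nhds_x_imp_x[OF polar] by (simp add: \<psi>_def)
  have \<psi>_der: "(\<psi> has_real_derivative d) (at t)"
    unfolding \<psi>_def d_def by (auto intro!: derivative_eq_intros comp)
  have "(arcsin has_real_derivative inverse (sqrt (1 - (\<psi> t)\<^sup>2))) (at (\<psi> t))"
    by (rule DERIV_arcsin) (simp_all add: \<psi>t)
  then have "((\<lambda>x. arcsin (\<psi> x)) has_real_derivative d) (at t)"
    using DERIV_chain2[OF _ \<psi>_der, of arcsin 1] by (simp add: \<psi>t)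
  then have sum_der: "((\<lambda>x. \<theta> t + arcsin (\<psi> x)) has_real_derivative d) (at t)"
    using DERIV_add[OF DERIV_const, of _ d t UNIV "\<theta> t"] by simp
  \<comment> \<open>Continuity of the angle selects the branch of the inverse sine.\<close>
  have branch: "\<forall>\<^sub>F x in nhds t. \<theta> t + arcsin (\<psi> x) = \<theta> x"
  proof -
    have "\<forall>\<^sub>F x in nhds t. dist (\<theta> x) (\<theta> t) < pi / 2"
      using cont unfolding continuous_at_eps_delta eventually_nhds_metric
      by (metis pi_half_gt_zero)
    with polar show ?thesis
    proof eventually_elim
      case (elim x)
      then have "\<psi> x = sin (\<theta> x - \<theta> t)"
        by (simp add: \<psi>_def sin_diff)
      moreover have "- (pi / 2) \<le> \<theta> x - \<theta> t" "\<theta> x - \<theta> t \<le> pi / 2"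
        using elim unfolding dist_real_def by linarith+
      ultimately show ?case
        by (simp add: arcsin_sin)
    qed
  qed
  have "(\<theta> has_real_derivative d) (at t)"
    using sum_der by (rule DERIV_cong_ev[OF refl branch refl, THEN iffD1])
  moreover have "\<bar>d\<bar> \<le> norm a"
  proof -
    \<comment> \<open>Pythagoras for the normal and tangential components of \<open>a\<close>.\<close>
    have "d\<^sup>2 + (a $ 1 * cos (\<theta> t) + a $ 2 * sin (\<theta> t))\<^sup>2
        = ((a $ 1)\<^sup>2 + (a $ 2)\<^sup>2) * ((sin (\<theta> t))\<^sup>2 + (cos (\<theta> t))\<^sup>2)"
      unfolding d_def by algebra
    then have "d\<^sup>2 \<le> (norm a)\<^sup>2"
      unfolding norm_real2_squared sin_cos_squared_add mult_1_right
      by (metis le_add_same_cancel1 zero_le_power2)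
    then show ?thesis
      by (simp add: abs_le_square_iff[symmetric])
  qed
  ultimately show ?thesis by blast
qed

lemma bounded_curvature_path_angle:
  assumes "bounded_curvature_path \<gamma> s"
  obtains \<theta> where
    "\<And>t. t \<in> {0..s} \<Longrightarrow> ((\<lambda>t. \<gamma> t $ 1) has_real_derivative cos (\<theta> t)) (at t within {0..s})"
    "\<And>t. t \<in> {0..s} \<Longrightarrow> ((\<lambda>t. \<gamma> t $ 2) has_real_derivative sin (\<theta> t)) (at t within {0..s})"
    "\<And>t u. t \<in> {0..s} \<Longrightarrow> u \<in> {0..s} \<Longrightarrow> \<bar>\<theta> t - \<theta> u\<bar> \<le> \<bar>t - u\<bar>"
proof -
  obtain T where T: "\<And>t. t \<in> {0..s} \<Longrightarrow> (\<gamma> has_vector_derivative T t) (at t within {0..s})"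
      "continuous_on {0..s} T" "T piecewise_C1_differentiable_on {0..s}"
      "\<And>t. t \<in> {0..s} \<Longrightarrow> norm (T t) = 1"
    and bound: "\<And>t a. t \<in> {0..s} \<Longrightarrow> (T has_vector_derivative a) (at t within {0..s}) \<Longrightarrow> norm a \<le> 1"
    using assms unfolding bounded_curvature_path_def by metis
  obtain \<theta> where \<theta>: "continuous_on {0..s} \<theta>"
    "\<And>t. t \<in> {0..s} \<Longrightarrow> T t $ 1 = cos (\<theta> t)" "\<And>t. t \<in> {0..s} \<Longrightarrow> T t $ 2 = sin (\<theta> t)"
    using ex_continuous_angle[OF T(2,4)] by metis
  have comp: "((\<lambda>t. \<gamma> t $ i) has_real_derivative T t $ i) (at t within {0..s})" if "t \<in> {0..s}" for i t
    using bounded_linear.has_vector_derivative[OF bounded_linear_vec_nth T(1)[OF that]]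
    by (simp add: has_real_derivative_iff_has_vector_derivative)
  obtain S D where S: "finite S"
      and D: "\<And>t. t \<in> {0..s} - S \<Longrightarrow> (T has_vector_derivative D t) (at t)"
    using T(3) unfolding piecewise_C1_differentiable_on_def C1_differentiable_on_def by metis
  have lip: "\<bar>\<theta> u - \<theta> t\<bar> \<le> u - t" if tu: "0 \<le> t" "t \<le> u" "u \<le> s" for t u
  proof (rule lipschitz_if_deriv_le_1_off_finite[OF \<open>t \<le> u\<close> S])
    show "continuous_on {t..u} \<theta>"
      using \<theta>(1) by (rule continuous_on_subset) (use tu in auto)
    fix x assume x: "x \<in> {t<..<u} - S"
    then have x': "x \<in> {0<..<s}" "x \<in> {0..s}" "x \<in> {0..s} - S"
      using tu by auto
    have "\<forall>\<^sub>F y in nhds x. y \<in> {0<..<s}"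
      using x'(1) by (intro eventually_nhds_in_open) auto
    then have "\<forall>\<^sub>F y in nhds x. T y $ 1 = cos (\<theta> y) \<and> T y $ 2 = sin (\<theta> y)"
      by eventually_elim (simp add: \<theta>)
    moreover have "isCont \<theta> x"
      using continuous_on_interior[OF \<theta>(1)] x'(1) by simp
    ultimately show "\<exists>d. (\<theta> has_real_derivative d) (at x) \<and> \<bar>d\<bar> \<le> 1"
      using angle_has_bounded_derivative[OF D[OF x'(3)]] 
        bound[OF x'(2) has_vector_derivative_at_within[OF D[OF x'(3)]]] by fastforce
  qed
  have "\<bar>\<theta> t - \<theta> u\<bar> \<le> \<bar>t - u\<bar>" if "t \<in> {0..s}" "u \<in> {0..s}" for t u
    using lip[of t u] lip[of u t] that by (cases "t \<le> u") auto
  then show ?thesis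
    using that comp \<theta>(2,3) by metis
qed

section \<open>Comparison with the unit circle\<close>

lemma cos_mono_abs:
  assumes "\<bar>x\<bar> \<le> \<bar>y\<bar>" "\<bar>y\<bar> \<le> pi"
  shows "cos y \<le> cos x"
  using cos_monotone_0_pi_le[of "\<bar>x\<bar>" "\<bar>y\<bar>"] assms by simp

text \<open>
  The comparison with a circular arc, in the direction of the tangent at the midpoint. The
  midpoint is the right base point because there \<open>\<bar>t - s/2\<bar> \<le> \<pi>\<close> holds on the whole interval
  when \<open>s \<le> 2\<pi>\<close>, and on \<open>[0, \<pi>]\<close> the cosine is strictly decreasing: this gives both the
  inequality and, in the equality case, the modulus of the angle.
\<close>

lemma short_closed_path_angle_from_midpoint:
  fixes \<gamma> :: "real \<Rightarrow> real^2" and \<theta> :: "real \<Rightarrow> real"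
  assumes "s > 0" "s \<le> 2 * pi" and closed: "\<gamma> 0 = \<gamma> s"
    and d1: "\<And>t. t \<in> {0..s} \<Longrightarrow> ((\<lambda>t. \<gamma> t $ 1) has_real_derivative cos (\<theta> t)) (at t within {0..s})"
    and d2: "\<And>t. t \<in> {0..s} \<Longrightarrow> ((\<lambda>t. \<gamma> t $ 2) has_real_derivative sin (\<theta> t)) (at t within {0..s})"
    and lip: "\<And>t u. t \<in> {0..s} \<Longrightarrow> u \<in> {0..s} \<Longrightarrow> \<bar>\<theta> t - \<theta> u\<bar> \<le> \<bar>t - u\<bar>"
  shows "s = 2 * pi \<and> (\<forall>t\<in>{0..s}. \<bar>\<theta> t - \<theta> (s/2)\<bar> = \<bar>t - s/2\<bar>)"
proof -
  define m where "m = s / 2"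
  have m: "m \<in> {0..s}"
    using \<open>s > 0\<close> by (simp add: m_def)
  have near: "\<bar>\<theta> t - \<theta> m\<bar> \<le> \<bar>t - m\<bar>" "\<bar>t - m\<bar> \<le> pi" if "t \<in> {0..s}" for t
    using lip[OF that m] that \<open>s \<le> 2 * pi\<close> by (auto simp: m_def field_simps)
  \<comment> \<open>Displacement along the tangent at \<open>m\<close>, minus that of the unit circle.\<close>
  define H where "H t = \<gamma> t $ 1 * cos (\<theta> m) + \<gamma> t $ 2 * sin (\<theta> m) - sin (t - m)" for t
  have H_der: "(H has_real_derivative cos (\<theta> t - \<theta> m) - cos (t - m)) (at t within {0..s})"
    if "t \<in> {0..s}" for t
    unfolding H_def
    by (rule derivative_eq_intros d1 d2 that refl)+ (simp add: cos_diff)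
  have H_der_nonneg: "0 \<le> cos (\<theta> t - \<theta> m) - cos (t - m)" if "t \<in> {0..s}" for t
    using cos_mono_abs[OF near[OF that]] by simp
  have "H s - H 0 = - 2 * sin (s / 2)"
    using closed by (simp add: H_def m_def)
  moreover have "0 \<le> sin (s / 2)"
    using assms(1,2) by (intro sin_ge_zero) auto
  ultimately have "H s \<le> H 0" by simp
  then have zero: "cos (\<theta> t - \<theta> m) - cos (t - m) = 0" if "t \<in> {0..s}" for t
    using nonneg_deriv_eq_0_if_no_increase[OF \<open>s > 0\<close> H_der H_der_nonneg] that by simp
  have eq: "\<bar>\<theta> t - \<theta> m\<bar> = \<bar>t - m\<bar>" if t: "t \<in> {0..s}" for t
    using zero[OF t] near[OF t] cos_inj_pi[of "\<bar>\<theta> t - \<theta> m\<bar>" "\<bar>t - m\<bar>"] by simp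
  moreover have "s = 2 * pi"
  proof (rule ccontr)
    assume "s \<noteq> 2 * pi"
    then have "0 < sin (s / 2)"
      using assms(1,2) by (intro sin_gt_zero) auto
    then have "H s < H 0"
      using \<open>H s - H 0 = - 2 * sin (s / 2)\<close> by simp
    moreover have "H 0 \<le> H s"
      using monotone_onD[OF nonneg_deriv_imp_mono_on[OF H_der H_der_nonneg]] \<open>s > 0\<close> by simp
    ultimately show False by simp
  qed
  ultimately show ?thesis
    unfolding m_def by blast
qed

text \<open>
  The angle at an end point tells which way that half turns: were \<open>\<theta> t - \<theta> \<pi>\<close> of the other
  sign at some \<open>t\<close> in the same half, the angle would change by more than the distance to the end
  point allows. The two halves turn the same way, since otherwise the displacement along the
  normal at the midpoint would be monotone and not constant, contradicting closedness.
\<close>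

lemma closed_path_turns_one_way:
  fixes \<gamma> :: "real \<Rightarrow> real^2" and \<theta> :: "real \<Rightarrow> real"
  assumes s: "s = 2 * pi" and closed: "\<gamma> 0 = \<gamma> s"
    and d1: "\<And>t. t \<in> {0..s} \<Longrightarrow> ((\<lambda>t. \<gamma> t $ 1) has_real_derivative cos (\<theta> t)) (at t within {0..s})"
    and d2: "\<And>t. t \<in> {0..s} \<Longrightarrow> ((\<lambda>t. \<gamma> t $ 2) has_real_derivative sin (\<theta> t)) (at t within {0..s})"
    and lip: "\<And>t u. t \<in> {0..s} \<Longrightarrow> u \<in> {0..s} \<Longrightarrow> \<bar>\<theta> t - \<theta> u\<bar> \<le> \<bar>t - u\<bar>"
    and dev: "\<And>t. t \<in> {0..s} \<Longrightarrow> \<bar>\<theta> t - \<theta> pi\<bar> = \<bar>t - pi\<bar>"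
  shows "\<exists>\<sigma>\<in>{-1, 1}. \<forall>t\<in>{0..s}. \<theta> t = \<theta> pi + \<sigma> * (t - pi)"
proof -
  have "\<exists>\<sigma>\<in>{-1, 1}. \<forall>t\<in>{pi..s}. \<theta> t = \<theta> pi + \<sigma> * (t - pi)"
  proof (cases "\<theta> s \<ge> \<theta> pi")
    case True
    then have "\<theta> s = \<theta> pi + pi"
      using dev[of s] s by simp
    then have "\<theta> t = \<theta> pi + 1 * (t - pi)" if "t \<in> {pi..s}" for t
    proof -
      have bounds: "\<bar>\<theta> t - \<theta> pi\<bar> \<le> t - pi" "\<bar>\<theta> s - \<theta> t\<bar> \<le> 2 * pi - t"
        using that dev[of t] lip[of s t] s by auto
      then show ?thesis
        using bounds[THEN abs_le_D1] \<open>\<theta> s = \<theta> pi + pi\<close> by simp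
    qed
    then show ?thesis by blast
  next
    case False
    then have "\<theta> s = \<theta> pi - pi"
      using dev[of s] s by simp
    then have "\<theta> t = \<theta> pi + (-1) * (t - pi)" if "t \<in> {pi..s}" for t
    proof -
      have bounds: "\<bar>\<theta> t - \<theta> pi\<bar> \<le> t - pi" "\<bar>\<theta> s - \<theta> t\<bar> \<le> 2 * pi - t"
        using that dev[of t] lip[of s t] s by auto
      then show ?thesis
        using bounds[THEN abs_le_D2] \<open>\<theta> s = \<theta> pi - pi\<close> by simp
    qed
    then show ?thesis by blast
  qed
  then obtain \<sigma> where \<sigma>: "\<sigma> \<in> {-1, 1}" "\<And>t. t \<in> {pi..s} \<Longrightarrow> \<theta> t = \<theta> pi + \<sigma> * (t - pi)"
    by blast
  have "\<exists>\<rho>\<in>{-1, 1}. \<forall>t\<in>{0..pi}. \<theta> t = \<theta> pi + \<rho> * (t - pi)"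
  proof (cases "\<theta> 0 \<ge> \<theta> pi")
    case True
    then have "\<theta> 0 = \<theta> pi + pi"
      using dev[of 0] s by simp
    then have "\<theta> t = \<theta> pi + (-1) * (t - pi)" if "t \<in> {0..pi}" for t
    proof -
      have bounds: "\<bar>\<theta> t - \<theta> pi\<bar> \<le> pi - t" "\<bar>\<theta> 0 - \<theta> t\<bar> \<le> t"
        using that dev[of t] lip[of 0 t] s by auto
      then show ?thesis
        using bounds[THEN abs_le_D1] \<open>\<theta> 0 = \<theta> pi + pi\<close> by simp
    qed
    then show ?thesis by blast
  next
    case False
    then have "\<theta> 0 = \<theta> pi - pi"
      using dev[of 0] s by simp
    then have "\<theta> t = \<theta> pi + 1 * (t - pi)" if "t \<in> {0..pi}" for t
    proof -
      have bounds: "\<bar>\<theta> t - \<theta> pi\<bar> \<le> pi - t" "\<bar>\<theta> 0 - \<theta> t\<bar> \<le> t"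
        using that dev[of t] lip[of 0 t] s by auto
      then show ?thesis
        using bounds[THEN abs_le_D2] \<open>\<theta> 0 = \<theta> pi - pi\<close> by simp
    qed
    then show ?thesis by blast
  qed
  then obtain \<rho> where \<rho>: "\<rho> \<in> {-1, 1}" "\<And>t. t \<in> {0..pi} \<Longrightarrow> \<theta> t = \<theta> pi + \<rho> * (t - pi)"
    by blast
  have "\<rho> = \<sigma>"
  proof (rule ccontr)
    assume "\<rho> \<noteq> \<sigma>"
    then have "\<rho> = - \<sigma>"
      using \<sigma>(1) \<rho>(1) by auto
    have "\<theta> t = \<theta> pi + \<sigma> * \<bar>t - pi\<bar>" if "t \<in> {0..s}" for t
      using that \<sigma>(2)[of t] \<rho>(2)[of t] \<open>\<rho> = - \<sigma>\<close> by (cases "t \<le> pi") (auto simp: algebra_simps)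
    then have normal: "\<sigma> * sin (\<theta> t - \<theta> pi) = sin \<bar>t - pi\<bar>" if "t \<in> {0..s}" for t
      using \<sigma>(1) that by auto
    \<comment> \<open>Displacement along the normal at \<open>\<pi>\<close>, with the sign that makes it nondecreasing.\<close>
    define K where "K t = \<sigma> * (\<gamma> t $ 2 * cos (\<theta> pi) - \<gamma> t $ 1 * sin (\<theta> pi))" for t
    have K_der: "(K has_real_derivative sin \<bar>t - pi\<bar>) (at t within {0..s})" if "t \<in> {0..s}" for t
      unfolding K_def normal[OF that, symmetric]
      by (rule derivative_eq_intros d1 d2 that refl)+ (simp add: sin_diff algebra_simps)
    \<comment> \<open>Any time other than \<open>0\<close>, \<open>\<pi>\<close> and \<open>2\<pi>\<close> would do; here the sine is 1.\<close>
    have "sin \<bar>pi / 2 - pi\<bar> = 0"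
    proof (rule nonneg_deriv_eq_0_if_no_increase[OF _ K_der])
      show "0 \<le> sin \<bar>t - pi\<bar>" if "t \<in> {0..s}" for t
        using that s by (intro sin_ge_zero) auto
    qed (use s closed in \<open>auto simp: K_def\<close>)
    then show False
      by simp
  qed
  then have "\<theta> t = \<theta> pi + \<sigma> * (t - pi)" if "t \<in> {0..s}" for t
    using that \<sigma>(2)[of t] \<rho>(2)[of t] by (cases "t \<le> pi") auto
  then show ?thesis
    using \<sigma>(1) by blast
qed

section \<open>Unit circles\<close>

lemma dist_1_real2_iff:
  fixes x c :: "real^2"
  shows "dist c x = 1 \<longleftrightarrow> (x$1 - c$1)\<^sup>2 + (x$2 - c$2)\<^sup>2 = 1"
proof -
  have "dist c x = 1 \<longleftrightarrow> (norm (x - c))\<^sup>2 = 1"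
    unfolding dist_norm norm_minus_commute[of c x]
    using power2_eq_1_iff[of "norm (x - c)"] norm_ge_zero[of "x - c"] by auto
  then show ?thesis
    by (simp only: norm_real2_squared vector_minus_component)
qed

text \<open>
  Integrating the tangent \<open>(cos (\<alpha> + \<sigma> t), sin (\<alpha> + \<sigma> t))\<close> gives coordinates of this form; the
  sign \<open>\<sigma>\<close> is the orientation.
\<close>

lemma unit_speed_circle_traverses_once:
  fixes \<gamma> :: "real \<Rightarrow> real^2"
  assumes \<sigma>: "\<sigma> \<in> {-1, 1 :: real}"
    and \<gamma>: "\<And>t. t \<in> {0..2*pi} \<Longrightarrow> \<gamma> t $ 1 = c $ 1 + \<sigma> * sin (\<alpha> + \<sigma> * t)"
           "\<And>t. t \<in> {0..2*pi} \<Longrightarrow> \<gamma> t $ 2 = c $ 2 - \<sigma> * cos (\<alpha> + \<sigma> * t)"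
  shows "traverses_once \<gamma> (2 * pi) (frontier (cball c 1))"
proof -
  have \<sigma>2: "\<sigma> * \<sigma> = 1" "\<sigma>\<^sup>2 = 1"
    using \<sigma> by auto
  have "\<gamma> ` {0..2*pi} = sphere c 1"
  proof (intro subset_antisym subsetI)
    fix x assume "x \<in> \<gamma> ` {0..2*pi}"
    then show "x \<in> sphere c 1"
      using \<gamma> \<sigma>2 by (auto simp: dist_1_real2_iff power_mult_distrib)
  next
    fix x :: "real^2" assume "x \<in> sphere c 1"
    \<comment> \<open>Solve \<open>sin (\<alpha> + \<sigma> t) = p\<close> and \<open>cos (\<alpha> + \<sigma> t) = q\<close> for \<open>t\<close>: rotating back by \<open>\<alpha>\<close>
      gives the cosine \<open>a\<close> and the sine \<open>b\<close> of \<open>t\<close>.\<close>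
    define p where "p = \<sigma> * (x$1 - c$1)"
    define q where "q = \<sigma> * (c$2 - x$2)"
    have "p\<^sup>2 + q\<^sup>2 = 1"
      using \<open>x \<in> sphere c 1\<close> \<sigma>2 
      by (simp add: dist_1_real2_iff p_def q_def power_mult_distrib power2_commute)
    define a where "a = q * cos \<alpha> + p * sin \<alpha>"
    define b where "b = \<sigma> * (p * cos \<alpha> - q * sin \<alpha>)"
    have "a\<^sup>2 + b\<^sup>2 = (p\<^sup>2 + q\<^sup>2) * ((sin \<alpha>)\<^sup>2 + (cos \<alpha>)\<^sup>2)"
      unfolding a_def b_def power_mult_distrib \<sigma>2 by algebra
    then have "a\<^sup>2 + b\<^sup>2 = 1"
      using \<open>p\<^sup>2 + q\<^sup>2 = 1\<close> by simp
    then obtain t where t: "0 \<le> t" "t < 2 * pi" "a = cos t" "b = sin t"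
      using sincos_total_2pi by metis
    have trig: "cos (\<sigma> * t) = a" "sin (\<sigma> * t) = \<sigma> * b"
      using \<sigma> t by auto
    have "sin (\<alpha> + \<sigma> * t) = p * ((sin \<alpha>)\<^sup>2 + (cos \<alpha>)\<^sup>2)"
      using \<sigma>2 unfolding sin_add trig a_def b_def by algebra
    moreover have "cos (\<alpha> + \<sigma> * t) = q * ((sin \<alpha>)\<^sup>2 + (cos \<alpha>)\<^sup>2)"
      using \<sigma>2 unfolding cos_add trig a_def b_def by algebra
    ultimately have "\<gamma> t $ 1 = x $ 1" "\<gamma> t $ 2 = x $ 2"
      using \<gamma>[of t] t \<sigma> by (auto simp: p_def q_def)
    then have "\<gamma> t = x"
      by (simp add: vec_eq_iff forall_2)
    then show "x \<in> \<gamma> ` {0..2*pi}"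
      using t by force
  qed
  moreover have "inj_on \<gamma> {0..<2*pi}"
  proof (rule inj_onI)
    fix t u assume tu: "t \<in> {0..<2*pi}" "u \<in> {0..<2*pi}" "\<gamma> t = \<gamma> u"
    then have "sin (\<alpha> + \<sigma> * t) = sin (\<alpha> + \<sigma> * u)" "cos (\<alpha> + \<sigma> * t) = cos (\<alpha> + \<sigma> * u)"
      using \<gamma>[of t] \<gamma>[of u] \<sigma> by auto
    then obtain n where "\<alpha> + \<sigma> * t = \<alpha> + \<sigma> * u + 2 * pi * of_int n"
      using sin_cos_eq_iff by metis
    then have "t - u = 2 * pi * of_int n \<or> t - u = - (2 * pi * of_int n)"
      using \<sigma> by auto
    then have n: "\<bar>t - u\<bar> = 2 * pi * \<bar>of_int n\<bar>"
      by (auto simp: abs_mult)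
    moreover have "\<bar>t - u\<bar> < 2 * pi"
      using tu by auto
    ultimately have "\<bar>of_int n\<bar> < (1 :: real)"
      by simp
    then have "n = 0"
      by linarith
    then show "t = u"
      using n by simp
  qed
  moreover have "\<gamma> 0 = \<gamma> (2 * pi)"
    using \<gamma>[of 0] \<gamma>[of "2*pi"] \<sigma> 
    by (auto simp: vec_eq_iff forall_2 sin_add cos_add)
  ultimately show ?thesis
    by (simp add: traverses_once_def)
qed

section \<open>Shortest closed paths\<close>

lemma closed_bounded_curvature_path_length:
  assumes "closed_bounded_curvature_path \<gamma> s"
  shows "2 * pi \<le> s"
proof (rule ccontr)
  assume "\<not> 2 * pi \<le> s"
  moreover have "s > 0" "\<gamma> 0 = \<gamma> s" "bounded_curvature_path \<gamma> s"
    using assms by (auto simp: closed_bounded_curvature_path_def bounded_curvature_path_def)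
  ultimately show False
    using short_closed_path_angle_from_midpoint[of s \<gamma>] bounded_curvature_path_angle[of \<gamma> s] by (smt (verit))
qed

lemma closed_bounded_curvature_path_2pi_circle:
  assumes "closed_bounded_curvature_path \<gamma> (2 * pi)"
  shows "\<exists>c. traverses_once \<gamma> (2 * pi) (frontier (cball c 1))"
proof -
  let ?I = "{0..2 * pi}"
  have bcp: "bounded_curvature_path \<gamma> (2 * pi)" and closed: "\<gamma> 0 = \<gamma> (2 * pi)"
    using assms by (auto simp: closed_bounded_curvature_path_def)
  obtain \<theta> where
    d1: "\<And>t. t \<in> ?I \<Longrightarrow> ((\<lambda>t. \<gamma> t $ 1) has_real_derivative cos (\<theta> t)) (at t within ?I)" and
    d2: "\<And>t. t \<in> ?I \<Longrightarrow> ((\<lambda>t. \<gamma> t $ 2) has_real_derivative sin (\<theta> t)) (at t within ?I)" and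
    lip: "\<And>t u. t \<in> ?I \<Longrightarrow> u \<in> ?I \<Longrightarrow> \<bar>\<theta> t - \<theta> u\<bar> \<le> \<bar>t - u\<bar>"
    using bounded_curvature_path_angle[OF bcp] by metis
  have "\<bar>\<theta> t - \<theta> pi\<bar> = \<bar>t - pi\<bar>" if "t \<in> ?I" for t
    using short_closed_path_angle_from_midpoint[OF _ _ closed d1 d2 lip] that by simp
  then obtain \<sigma> where \<sigma>: "\<sigma> \<in> {-1, 1}" and \<theta>: "\<forall>t\<in>?I. \<theta> t = \<theta> pi + \<sigma> * (t - pi)"
    using closed_path_turns_one_way[OF refl closed d1 d2 lip] by metis
  \<comment> \<open>The angle at time 0.\<close>
  define \<alpha> where "\<alpha> = \<theta> pi - \<sigma> * pi"
  have \<theta>\<alpha>: "\<theta> t = \<alpha> + \<sigma> * t" if "t \<in> ?I" for t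
    using \<theta> that by (simp add: \<alpha>_def algebra_simps)
  have "((\<lambda>t. \<gamma> t $ 1 - \<sigma> * sin (\<alpha> + \<sigma> * t)) has_real_derivative 0) (at t within ?I)"
    if "t \<in> ?I" for t
    by (rule derivative_eq_intros d1 that refl)+ (use \<sigma> that in \<open>auto simp: \<theta>\<alpha>\<close>)
  then obtain c1 where c1: "\<And>t. t \<in> ?I \<Longrightarrow> \<gamma> t $ 1 - \<sigma> * sin (\<alpha> + \<sigma> * t) = c1"
    using has_field_derivative_zero_constant[of ?I "\<lambda>t. \<gamma> t $ 1 - \<sigma> * sin (\<alpha> + \<sigma> * t)"] by auto
  have "((\<lambda>t. \<gamma> t $ 2 + \<sigma> * cos (\<alpha> + \<sigma> * t)) has_real_derivative 0) (at t within ?I)"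
    if "t \<in> ?I" for t
    by (rule derivative_eq_intros d2 that refl)+ (use \<sigma> that in \<open>auto simp: \<theta>\<alpha>\<close>)
  then obtain c2 where c2: "\<And>t. t \<in> ?I \<Longrightarrow> \<gamma> t $ 2 + \<sigma> * cos (\<alpha> + \<sigma> * t) = c2"
    using has_field_derivative_zero_constant[of ?I "\<lambda>t. \<gamma> t $ 2 + \<sigma> * cos (\<alpha> + \<sigma> * t)"] by auto
  define c :: "real^2" where "c = vector [c1, c2]"
  have "\<gamma> t $ 1 = c $ 1 + \<sigma> * sin (\<alpha> + \<sigma> * t)" "\<gamma> t $ 2 = c $ 2 - \<sigma> * cos (\<alpha> + \<sigma> * t)"
    if "t \<in> ?I" for t
    using c1[OF that] c2[OF that] by (simp_all add: c_def)
  then show ?thesis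
    using unit_speed_circle_traverses_once[OF \<sigma>] by blast
qed

text \<open>
  The length \<open>2\<pi>\<close> is attained, which also bounds the length of a shortest path from above.
\<close>

lemma unit_circle_closed_bounded_curvature_path:
  "closed_bounded_curvature_path (\<lambda>t. vector [cos t, sin t]) (2 * pi)"
proof -
  have vec: "vector [x, y] = x *\<^sub>R axis 1 1 + y *\<^sub>R (axis 2 1 :: real^2)" for x y :: real
    by (simp add: vec_eq_iff forall_2 axis_def)
  have norm: "norm (vector [x, y] :: real^2) = 1" if "x\<^sup>2 + y\<^sup>2 = 1" for x y :: real
    using that norm_real2_squared[of "vector [x, y]"] dist_1_real2_iff[of 0 "vector [x, y]"] by simp
  let ?T = "\<lambda>t. vector [- sin t, cos t] :: real^2"
  have der: "((\<lambda>t. vector [cos t, sin t] :: real^2) has_vector_derivative ?T t) (at t within A)" for t A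
    unfolding vec
    by (auto intro!: derivative_eq_intros)
  have der2: "(?T has_vector_derivative vector [- cos t, - sin t]) (at t within A)" for t A
    unfolding vec
    by (auto intro!: derivative_eq_intros)
  have contT: "continuous_on A ?T" for A
    unfolding vec by (intro continuous_intros)
  have "?T C1_differentiable_on {0..2*pi}"
    unfolding C1_differentiable_on_def
    by (rule exI[of _ "\<lambda>t. vector [- cos t, - sin t]"])
       (auto simp: der2, auto simp: vec intro!: continuous_intros)
  then have C1: "?T piecewise_C1_differentiable_on {0..2*pi}"
    using C1_differentiable_imp_piecewise by blast
  have bound: "norm a \<le> 1"
    if "t \<in> {0..2*pi}" "(?T has_vector_derivative a) (at t within {0..2*pi})" for t a
  proof -
    have "a = vector [- cos t, - sin t]"
      using vector_derivative_unique_within_closed_interval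
        [of 0 "2 * pi" t ?T a "vector [- cos t, - sin t]"] that der2 by simp
    then show ?thesis
      using norm[of "- cos t" "- sin t"] by simp
  qed
  have "bounded_curvature_path (\<lambda>t. vector [cos t, sin t]) (2 * pi)"
    unfolding bounded_curvature_path_def
    by (intro conjI exI[of _ ?T] ballI allI impI der contT C1 bound norm) auto
  then show ?thesis
    by (simp add: closed_bounded_curvature_path_def)
qed

theorem theorem4p6:
  shows "(\<exists>\<gamma> s. shortest_closed_bounded_curvature_path \<gamma> s) \<and>
         (\<forall>\<gamma> s. shortest_closed_bounded_curvature_path \<gamma> s \<longrightarrow>
                 (\<exists>c. traverses_once \<gamma> s (frontier (cball c 1)))) \<and>
         (\<forall>\<gamma> s. closed_bounded_curvature_path \<gamma> s \<longrightarrow> s \<ge> 2 * pi)"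
proof (intro conjI allI impI)
  show "\<exists>\<gamma> s. shortest_closed_bounded_curvature_path \<gamma> s"
    using unit_circle_closed_bounded_curvature_path closed_bounded_curvature_path_length
    unfolding shortest_closed_bounded_curvature_path_def by blast
next
  fix \<gamma> :: "real \<Rightarrow> real^2" and s
  assume shortest: "shortest_closed_bounded_curvature_path \<gamma> s"
  then have "closed_bounded_curvature_path \<gamma> s" "s \<le> 2 * pi"
    using unit_circle_closed_bounded_curvature_path
    unfolding shortest_closed_bounded_curvature_path_def by blast+
  moreover from this have "s = 2 * pi"
    using closed_bounded_curvature_path_length by fastforce
  ultimately show "\<exists>c. traverses_once \<gamma> s (frontier (cball c 1))"
    using closed_bounded_curvature_path_2pi_circle by simp
next
  fix \<gamma> :: "real \<Rightarrow> real^2" and s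
  assume "closed_bounded_curvature_path \<gamma> s"
  then show "s \<ge> 2 * pi"
    by (rule closed_bounded_curvature_path_length)
qed

end
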